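(* Let $a,b,c,d>0$ with $ad>bc$, and let $\{W_n(z)\}_{n\ge0}$ be defined by $W_0(z)=1$, $W_1(z)=z$, $W_n(z)=(az+b)W_{n-1}(z)+(cz+d)W_{n-2}(z)$ for $n\ge2$. Let $\Delta_\Delta=-a^2d+abc+c^2$, $\Delta_g=(b+c)^2+4d(1-a)$, $x_\Delta^{\pm}=\frac{-ab-2c\pm2\sqrt{\Delta_\Delta}}{a^2}$, $h(z)=(2-a)z-b$, and suppose $h(x_\Delta^\pm)$ are real with $h(x_\Delta^+)<0<h(x_\Delta^-)$. Let $n^-=-(ax_\Delta^-+b)/h(x_\Delta^-)$. Then for every integer $n>n^-$, the polynomial $W_n(z)$ has at least one real zero; if in addition $\Delta_g\ge0$, then $W_n(z)$ has at least two distinct real zeros for every $n>n^-$. *)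

theory Defs
  imports Complex_Main "HOL-Computational_Algebra.Polynomial" "HOL-Analysis.Complex_Transcendental"
begin

fun W :: "real \<Rightarrow> real \<Rightarrow> real \<Rightarrow> real \<Rightarrow> nat \<Rightarrow> real poly" where
  "W a b c d 0 = 1"
| "W a b c d (Suc 0) = [:0, 1:]"
| "W a b c d (Suc (Suc n)) = [:b, a:] * W a b c d (Suc n) + [:d, c:] * W a b c d n"

definition Delta_Delta :: "real \<Rightarrow> real \<Rightarrow> real \<Rightarrow> real \<Rightarrow> real" where
  "Delta_Delta a b c d = - (a\<^sup>2) * d + a * b * c + c\<^sup>2"

definition Delta_g :: "real \<Rightarrow> real \<Rightarrow> real \<Rightarrow> real \<Rightarrow> real" where
  "Delta_g a b c d = (b + c)\<^sup>2 + 4 * d * (1 - a)"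

text \<open>
  The numbers \<open>x_Delta_minus\<close> and \<open>x_Delta_plus\<close> are the zeros of the discriminant
  \<open>(a z + b)\<^sup>2 + 4 (c z + d)\<close> of the characteristic polynomial of the recurrence.
  They may be non-real (\<open>Delta_Delta < 0\<close>), so they and \<open>h\<close> are complex valued;
  the real square root of Isabelle would return a spurious real number for negative arguments.
\<close>

definition x_Delta_plus :: "real \<Rightarrow> real \<Rightarrow> real \<Rightarrow> real \<Rightarrow> complex" where
  "x_Delta_plus a b c d =
     (- of_real a * of_real b - 2 * of_real c + 2 * csqrt (of_real (Delta_Delta a b c d)))
       / (of_real a)\<^sup>2"

definition x_Delta_minus :: "real \<Rightarrow> real \<Rightarrow> real \<Rightarrow> real \<Rightarrow> complex" where
  "x_Delta_minus a b c d =
     (- of_real a * of_real b - 2 * of_real c - 2 * csqrt (of_real (Delta_Delta a b c d)))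
       / (of_real a)\<^sup>2"

definition h :: "real \<Rightarrow> real \<Rightarrow> complex \<Rightarrow> complex" where
  "h a b z = (2 - of_real a) * z - of_real b"

text \<open>Only \<open>Re (n_minus a b c d)\<close> is used below: the number is real whenever \<open>x_Delta_minus\<close> is.\<close>

definition n_minus :: "real \<Rightarrow> real \<Rightarrow> real \<Rightarrow> real \<Rightarrow> complex" where
  "n_minus a b c d =
     - (of_real a * x_Delta_minus a b c d + of_real b) / h a b (x_Delta_minus a b c d)"

end

theory Submission imports Defs begin

text \<open>
  The hypotheses force \<open>a > 2\<close> and \<open>Delta_Delta > 0\<close>. At the two discriminant zeros \<open>x\<close> the
  characteristic polynomial of the recurrence has the double root \<open>t = (a x + b) / 2 < 0\<close>, so
  \<open>W\<^sub>n(x) = t ^ n (1 + n (x - t) / t)\<close>. Hence \<open>(-1) ^ n W\<^sub>n\<close> is negative at \<open>x_Delta_minus\<close> once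
  \<open>n > n_minus\<close>, and positive at \<open>x_Delta_plus\<close>. Having a positive leading coefficient,
  \<open>W\<^sub>n\<close> also makes \<open>(-1) ^ n W\<^sub>n\<close> positive near \<open>-\<infinity>\<close>. This gives one zero on each side of
  \<open>x_Delta_minus\<close>.
\<close>

text \<open>In each recurrence step the summand with factor \<open>[:b, a:]\<close> has strictly
  larger degree, so the leading coefficient is multiplied by \<open>a\<close>.\<close>

lemma degree_lead_coeff_W:
  assumes "a > 0"
  shows "degree (W a b c d n) = n \<and> lead_coeff (W a b c d n) > 0"
proof (induction n rule: induct_nat_012)
  case (ge2 n)
  let ?p = "[:b, a:] * W a b c d (Suc n)" and ?q = "[:d, c:] * W a b c d n"
  have "W a b c d (Suc n) \<noteq> 0" using ge2 by auto
  then have dp: "degree ?p = Suc (Suc n)" using ge2 assms by (subst degree_mult_eq) auto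
  have "degree ?q \<le> degree [:d, c:] + degree (W a b c d n)" by (rule degree_mult_le)
  also have "\<dots> < Suc (Suc n)" using ge2 by simp
  finally have dq: "degree ?q < degree ?p" using dp by simp
  have lp: "lead_coeff ?p > 0" unfolding lead_coeff_mult using ge2 assms by (intro mult_pos_pos) auto
  have "degree (?p + ?q) = degree ?p" using dq by (rule degree_add_eq_left)
  moreover have "lead_coeff (?p + ?q) = lead_coeff ?p"
    using lead_coeff_add_le[OF dq] by (simp only: add.commute)
  ultimately show ?case using dp lp unfolding W.simps(3) by metis
qed auto

text \<open>The assumptions make the characteristic polynomial at \<open>z\<close> equal to
  \<open>(X - t)\<^sup>2\<close>. The closed form is multiplied through by \<open>t\<close>, so that
  \<open>t = 0\<close> needs no separate case.\<close>

lemma W_double_root: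
  fixes t z :: real
  assumes "a * z + b = 2 * t" and "c * z + d = - t\<^sup>2"
  shows "t * poly (W a b c d n) z = t ^ n * (t + real n * (z - t))"
proof (induction n rule: induct_nat_012)
  case (ge2 n)
  have "t * poly (W a b c d (Suc (Suc n))) z
      = (a * z + b) * (t * poly (W a b c d (Suc n)) z) + (c * z + d) * (t * poly (W a b c d n) z)"
    by (simp add: algebra_simps)
  also have "\<dots> = t ^ Suc (Suc n) * (t + real (Suc (Suc n)) * (z - t))"
    unfolding ge2 assms by (simp add: algebra_simps power2_eq_square)
  finally show ?case .
qed (simp_all add: algebra_simps)

text \<open>Reflecting by \<open>x \<mapsto> -x\<close> reduces this to the behaviour at plus
  infinity.\<close>

lemma poly_alternating_at_bot:
  fixes p :: "real poly"
  assumes "lead_coeff p > 0"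
  obtains x where "x < u" and "(-1) ^ degree p * poly p x > 0"
proof -
  let ?q = "smult ((-1) ^ degree p) (pcompose p [:0, -1:])"
  have "lead_coeff ?q = lead_coeff p"
    unfolding lead_coeff_smult
    by (subst lead_coeff_comp) (simp_all add: mult.left_commute flip: power_mult_distrib)
  then obtain N where N: "\<And>x. x \<ge> N \<Longrightarrow> poly ?q x \<ge> lead_coeff p"
    using poly_pinfty_gt_lc[of ?q] assms by metis
  \<comment> \<open>The bound \<open>1 - u\<close> ensures \<open>- ?x < u\<close>.\<close>
  let ?x = "max N (1 - u)"
  have "poly ?q ?x > 0" using N[of ?x] assms by linarith
  then show thesis by (intro that[of "- ?x"]) (auto simp: poly_pcompose)
qed

lemma poly_sign_change:
  fixes p :: "real poly"
  assumes "u < v" and "poly p u * poly p v < 0"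
  obtains x where "u < x" and "x < v" and "poly p x = 0"
  using assms poly_IVT by metis

lemma alternating_prod_neg:
  fixes x y :: real
  assumes "(-1) ^ n * x < 0" and "(-1) ^ n * y > 0"
  shows "x * y < 0"
  using mult_neg_pos[OF assms] by (simp add: algebra_simps flip: power_mult_distrib)

theorem theorem4p3:
  fixes a b c d :: real
  assumes "a > 0" and "b > 0" and "c > 0" and "d > 0"
    and "a * d > b * c"
    and "h a b (x_Delta_plus a b c d) \<in> \<real>"
    and "h a b (x_Delta_minus a b c d) \<in> \<real>"
    and "Re (h a b (x_Delta_plus a b c d)) < 0"
    and "0 < Re (h a b (x_Delta_minus a b c d))"
  shows "(\<forall>n. real n > Re (n_minus a b c d) \<longrightarrow> (\<exists>x. poly (W a b c d n) x = 0)) \<and>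
         (Delta_g a b c d \<ge> 0 \<longrightarrow>
           (\<forall>n. real n > Re (n_minus a b c d) \<longrightarrow>
             (\<exists>x y. x \<noteq> y \<and> poly (W a b c d n) x = 0 \<and> poly (W a b c d n) y = 0)))"
proof -
  let ?D = "Delta_Delta a b c d"
  define r where "r = csqrt (of_real ?D)"
  define k where "k = 4 * (2 - a) / a\<^sup>2"
  have diff: "h a b (x_Delta_plus a b c d) - h a b (x_Delta_minus a b c d) = of_real k * r"
    using \<open>a > 0\<close>
    by (simp add: h_def x_Delta_plus_def x_Delta_minus_def k_def r_def field_simps)
  \<comment> \<open>The two values of \<open>h\<close> are real and distinct, so
    \<open>k * r\<close> is real and \<open>k\<close> is nonzero; hence \<open>r\<close> is
    real.\<close>
  have "Im (of_real k * r) = 0"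
    using assms(6,7) unfolding diff[symmetric] complex_is_Real_iff by simp
  moreover have neg: "k * Re r < 0"
    using assms(8,9) arg_cong[OF diff, of Re] by simp
  ultimately have "Im r = 0" by auto
  define s where "s = Re r"
  have r: "r = of_real s" using \<open>Im r = 0\<close> by (simp add: complex_eq_iff s_def)
  \<comment> \<open>The principal root has nonnegative real part, and \<open>neg\<close> excludes
    zero.\<close>
  have "s > 0" using neg Re_csqrt[of "of_real ?D"] unfolding s_def[symmetric] r_def[symmetric]
    by (cases "s = 0") auto
  have "r\<^sup>2 = of_real ?D" by (simp add: r_def)
  then have s2: "s\<^sup>2 = - (a\<^sup>2) * d + a * b * c + c\<^sup>2"
    unfolding r Delta_Delta_def by (metis of_real_eq_iff of_real_power)
  \<comment> \<open>\<open>s\<^sup>2 = c\<^sup>2 - a * (a * d - b * c)\<close>, so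
    \<open>a * d > b * c\<close> bounds \<open>s\<close> by \<open>c\<close>; this will make
    \<open>tv\<close> negative.\<close>
  have "a * (b * c) < a * (a * d)" using assms by simp
  then have "s\<^sup>2 < c\<^sup>2" unfolding s2 by (simp add: power2_eq_square algebra_simps)
  then have "s < c" using \<open>c > 0\<close> by (simp add: power2_less_imp_less)

  define u v where "u = (- a * b - 2 * c - 2 * s) / a\<^sup>2" and "v = (- a * b - 2 * c + 2 * s) / a\<^sup>2"
  define tu tv where "tu = (- c - s) / a" and "tv = (- c + s) / a"
  have xu: "x_Delta_minus a b c d = of_real u" and xv: "x_Delta_plus a b c d = of_real v"
    by (simp_all add: x_Delta_minus_def x_Delta_plus_def r r_def[symmetric] u_def v_def)
  have "u < v" using \<open>s > 0\<close> \<open>a > 0\<close> by (simp add: u_def v_def divide_strict_right_mono)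
  have "tu < 0" "tv < 0"
    using \<open>s > 0\<close> \<open>s < c\<close> \<open>a > 0\<close> by (auto simp: tu_def tv_def divide_neg_pos)
  have A: "a * u + b = 2 * tu" "a * v + b = 2 * tv"
    using \<open>a > 0\<close> by (simp_all add: u_def v_def tu_def tv_def field_simps power2_eq_square)
  \<comment> \<open>Eliminating \<open>d\<close> in favour of \<open>s\<close> turns
    \<open>B\<close> into identities of rational functions.\<close>
  have d: "d = (a * b * c + c\<^sup>2 - s\<^sup>2) / a\<^sup>2"
    using \<open>a > 0\<close> s2 by (simp add: field_simps)
  have B: "c * u + d = - tu\<^sup>2" "c * v + d = - tv\<^sup>2"
    unfolding d using \<open>a > 0\<close>
    by (simp_all add: u_def v_def tu_def tv_def field_simps power2_eq_square)
  \<comment> \<open>Since \<open>h\<close> is \<open>2 * z - (a * z + b)\<close>, the sign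
    hypotheses on \<open>h\<close> become signs of \<open>u - tu\<close> and
    \<open>v - tv\<close>.\<close>
  have hu: "h a b (of_real z) = of_real (2 * (z - t))" if "a * z + b = 2 * t" for z t
  proof -
    have "(2 - a) * z - b = 2 * (z - t)" using that by (simp add: algebra_simps)
    then show ?thesis unfolding h_def by (metis of_real_diff of_real_mult of_real_numeral)
  qed
  have pos: "u - tu > 0" and "v - tv < 0"
    using assms(8,9) unfolding xu xv hu[OF A(1)] hu[OF A(2)] by simp_all
  have nm: "Re (n_minus a b c d) = - tu / (u - tu)"
  proof -
    have "n_minus a b c d = of_real (- (2 * tu) / (2 * (u - tu)))"
      unfolding n_minus_def xu hu[OF A(1)] A(1)[symmetric] by simp
    moreover have "- (2 * tu) / (2 * (u - tu)) = - tu / (u - tu)"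
      using pos by (simp add: field_simps)
    ultimately show ?thesis by (metis Re_complex_of_real)
  qed
  have two: "\<exists>x y. x \<noteq> y \<and> poly (W a b c d n) x = 0 \<and> poly (W a b c d n) y = 0"
    if n: "real n > Re (n_minus a b c d)" for n
  proof -
    let ?p = "W a b c d n"
    have sgn: "(-1) ^ n * poly ?p z = (- t) ^ n * (t + real n * (z - t)) / t"
      if "a * z + b = 2 * t" "c * z + d = - t\<^sup>2" "t < 0" for z t
    proof -
      have "poly ?p z = t ^ n * (t + real n * (z - t)) / t"
        using W_double_root[OF that(1,2), of n] that(3) by (simp add: field_simps)
      then show ?thesis by (simp add: power_minus[of t])
    qed
    \<comment> \<open>This is the condition \<open>n > - tu / (u - tu)\<close> cleared of its
      positive denominator.\<close>
    have "tu + real n * (u - tu) > 0" using n pos unfolding nm by (simp add: field_simps)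
    then have neg_u: "(-1) ^ n * poly ?p u < 0"
      unfolding sgn[OF A(1) B(1) \<open>tu < 0\<close>]
      using \<open>tu < 0\<close> by (intro divide_pos_neg mult_pos_pos zero_less_power) auto
    \<comment> \<open>At \<open>v\<close> both summands of the bracket are nonpositive and
      \<open>tv\<close> is strictly negative, so no threshold on \<open>n\<close> enters.\<close>
    have "real n * (v - tv) \<le> 0" using \<open>v - tv < 0\<close> by (intro mult_nonneg_nonpos) auto
    then have "tv + real n * (v - tv) < 0" using \<open>tv < 0\<close> by linarith
    then have pos_v: "(-1) ^ n * poly ?p v > 0"
      unfolding sgn[OF A(2) B(2) \<open>tv < 0\<close>]
      using \<open>tv < 0\<close> by (intro divide_neg_neg mult_pos_neg zero_less_power) auto
    obtain w where "w < u" and pos_w: "(-1) ^ n * poly ?p w > 0"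
      using poly_alternating_at_bot[of ?p u] degree_lead_coeff_W[OF \<open>a > 0\<close>] by metis
    \<comment> \<open>The sign at \<open>u\<close> differs from those at \<open>w\<close> and
      \<open>v\<close>; the point \<open>u\<close> separates the two zeros and so makes them
      distinct.\<close>
    obtain x where "x < u" "poly ?p x = 0"
      using poly_sign_change[OF \<open>w < u\<close>] alternating_prod_neg[OF neg_u pos_w]
      by (metis mult.commute)
    moreover obtain y where "u < y" "poly ?p y = 0"
      using poly_sign_change[OF \<open>u < v\<close> alternating_prod_neg[OF neg_u pos_v]] .
    ultimately show ?thesis by (intro exI[of _ x] exI[of _ y]) auto
  qed
  then show ?thesis by blast
qed

end
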